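(* Let $1<p<\infty$, let $m$ be a positive integer, let $a_1,\dots,a_m$ be real numbers, and let $Q_m:l_p\to l_p$ be the polynomial type operator $Q_m(x)=\left\{\sum_{i=1}^m a_i t_n^i\right\}_{n=1}^\infty$ for $x=\{t_n\}_{n=1}^\infty\in l_p$. Then $Q_m$ is Fréchet differentiable on $l_p$, and for every $\bar x=\{\bar t_n\}_{n=1}^\infty\in l_p$ the Fréchet derivative $\nabla Q_m(\bar x):l_p\to l_p$ satisfies: (i) If $m>1$, then $\nabla Q_m(\bar x)$ is represented by the infinite diagonal matrix with $n$-th diagonal entry $\sum_{i=1}^m i a_i\bar t_n^{\,i-1}$, i.e. $$\nabla Q_m(\bar x)(x)=\left\{\sum_{i=1}^m i a_i\bar t_n^{\,i-1}t_n\right\}_{n=1}^\infty\in l_p\quad\text{for every } x=\{t_n\}_{n=1}^\infty\in l_p.$$ (ii) If $m=1$, then $\nabla Q_1(\bar x)(x)=a_1x=\{a_1t_n\}_{n=1}^\infty\in l_p$ for every $x=\{t_n\}_{n=1}^\infty\in l_p$.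
   Context: $l_p$ is the Banach space of real sequences $x=\{t_n\}_{n=1}^\infty$ with $\|x\|_p=(\sum_n|t_n|^p)^{1/p}<\infty$ and origin $\theta_p$. A map $T:l_p\to l_p$ is Fréchet differentiable at $\bar x$ with derivative $\nabla T(\bar x)$ if $\nabla T(\bar x):l_p\to l_p$ is continuous linear and $\lim_{u\to\theta_p}\frac{T(\bar x+u)-T(\bar x)-\nabla T(\bar x)(u)}{\|u\|_p}=\theta_p$; Fréchet differentiable on $l_p$ means at every point. The convention $t^0=1$ (including $0^0=1$) is used. *)

theory Defs
  imports "HOL-Analysis.Analysis"
begin

text \<open>
  Sequences are indexed from 0 instead of 1. The space \<open>l\<^sub>p\<close> is a carrier set rather than a type,
  since the exponent is a real number.
\<close>

definition lp :: "real \<Rightarrow> (nat \<Rightarrow> real) set"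
  where "lp p = {x. summable (\<lambda>n. \<bar>x n\<bar> powr p)}"

definition lp_norm :: "real \<Rightarrow> (nat \<Rightarrow> real) \<Rightarrow> real"
  where "lp_norm p x = (\<Sum>n. \<bar>x n\<bar> powr p) powr (1 / p)"

definition lp_dist :: "real \<Rightarrow> (nat \<Rightarrow> real) \<Rightarrow> (nat \<Rightarrow> real) \<Rightarrow> real"
  where "lp_dist p x y = lp_norm p (\<lambda>n. x n - y n)"

text \<open>Meaningful for \<open>p \<ge> 1\<close> only; see \<open>Metric_space_lp\<close> below.\<close>

definition lp_topology :: "real \<Rightarrow> (nat \<Rightarrow> real) topology"
  where "lp_topology p = Metric_space.mtopology (lp p) (lp_dist p)"

lemma powr_convex_comb:
  fixes s t u v p :: real
  assumes p: "1 \<le> p" and s: "0 \<le> s" and t: "0 \<le> t" and u: "0 < u" and v: "0 < v" and uv: "u + v = 1"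
  shows "(u * s + v * t) powr p \<le> u * s powr p + v * t powr p"
proof -
  have le: "c powr p \<le> c" if "0 < c" "c \<le> 1" for c :: real
    using powr_mono'[of 1 p c] that p by simp
  have *: "(c * r) powr p \<le> c * r powr p" if "0 < c" "c \<le> 1" "0 \<le> r" for c r :: real
    using mult_right_mono[OF le[OF that(1,2)], of "r powr p"] that by (simp add: powr_mult)
  consider "s = 0" | "t = 0" | "0 < s" "0 < t" using s t by linarith
  then show ?thesis
  proof cases
    case 1 then show ?thesis using *[of v t] t u v uv by simp
  next
    case 2 then show ?thesis using *[of u s] s u v uv by simp
  next
    case 3
    have "u = 1 - v" using uv by simp
    then show ?thesis
      using convex_onD[OF powr_convex[OF p], of v s t] 3 u v by simp
  qed
qed

lemma lp_norm_nonneg: "0 \<le> lp_norm p x"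
  by (simp add: lp_norm_def)

lemma lp_norm_powr:
  assumes "1 \<le> p" "x \<in> lp p" shows "lp_norm p x powr p = (\<Sum>n. \<bar>x n\<bar> powr p)"
  using assms by (simp add: lp_norm_def lp_def powr_powr suminf_nonneg)

lemma lp_norm_eq_0_iff:
  assumes "1 \<le> p" "x \<in> lp p" shows "lp_norm p x = 0 \<longleftrightarrow> x = (\<lambda>n. 0)"
  using assms by (auto simp: lp_norm_def lp_def suminf_eq_zero_iff)

lemma lp_Minkowski:
  assumes p: "1 \<le> p" and x: "x \<in> lp p" and y: "y \<in> lp p"
  shows "(\<lambda>n. x n + y n) \<in> lp p" "lp_norm p (\<lambda>n. x n + y n) \<le> lp_norm p x + lp_norm p y"
proof -
  let ?a = "lp_norm p x" and ?b = "lp_norm p y"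
  have "(\<lambda>n. x n + y n) \<in> lp p \<and> lp_norm p (\<lambda>n. x n + y n) \<le> ?a + ?b"
  proof (cases "?a = 0 \<or> ?b = 0")
    case True
    then show ?thesis
      using x y p lp_norm_nonneg[of p] by (auto simp: lp_norm_eq_0_iff)
  next
    case False
    then have a: "0 < ?a" and b: "0 < ?b"
      using lp_norm_nonneg[of p x] lp_norm_nonneg[of p y] by linarith+
    let ?u = "?a / (?a + ?b)" and ?v = "?b / (?a + ?b)"
    let ?K = "(?a + ?b) powr p"
    define g where "g n = ?K * (?u * (\<bar>x n\<bar> powr p / ?a powr p) + ?v * (\<bar>y n\<bar> powr p / ?b powr p))" for n
    have uv: "?u + ?v = 1" using a b by (simp flip: add_divide_distrib)
    have bound: "\<bar>x n + y n\<bar> powr p \<le> g n" for n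
    proof -
      have eq: "\<bar>x n\<bar> + \<bar>y n\<bar> = (?a + ?b) * (?u * (\<bar>x n\<bar> / ?a) + ?v * (\<bar>y n\<bar> / ?b))"
        using a b by (simp add: distrib_left)
      have "\<bar>x n + y n\<bar> powr p \<le> (\<bar>x n\<bar> + \<bar>y n\<bar>) powr p"
        using p by (intro powr_mono2) auto
      also have "\<dots> = ?K * (?u * (\<bar>x n\<bar> / ?a) + ?v * (\<bar>y n\<bar> / ?b)) powr p"
        unfolding eq using a b by (intro powr_mult)
      also have "\<dots> \<le> ?K * (?u * (\<bar>x n\<bar> / ?a) powr p + ?v * (\<bar>y n\<bar> / ?b) powr p)"
        using a b p uv by (intro mult_left_mono powr_convex_comb) auto
      also have "\<dots> = g n"
        using a b by (simp add: g_def powr_divide)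
      finally show ?thesis .
    qed
    have sx: "(\<lambda>n. \<bar>x n\<bar> powr p / ?a powr p) sums 1"
      using x a sums_divide[OF summable_sums, of "\<lambda>n. \<bar>x n\<bar> powr p" "?a powr p"]
      by (simp add: lp_def lp_norm_powr[OF p x, symmetric])
    have sy: "(\<lambda>n. \<bar>y n\<bar> powr p / ?b powr p) sums 1"
      using y b sums_divide[OF summable_sums, of "\<lambda>n. \<bar>y n\<bar> powr p" "?b powr p"]
      by (simp add: lp_def lp_norm_powr[OF p y, symmetric])
    have g: "g sums ?K"
      using sums_mult[OF sums_add[OF sums_mult[OF sx, of ?u] sums_mult[OF sy, of ?v]], of ?K] uv
      by (simp add: g_def[abs_def])
    have sm: "summable (\<lambda>n. \<bar>x n + y n\<bar> powr p)"
      using bound by (intro summable_comparison_test'[OF sums_summable[OF g]]) auto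
    have "(\<Sum>n. \<bar>x n + y n\<bar> powr p) \<le> ?K"
      using suminf_le[OF bound sm sums_summable[OF g]] sums_unique[OF g] by simp
    then have "lp_norm p (\<lambda>n. x n + y n) \<le> ?K powr (1 / p)"
      unfolding lp_norm_def using p sm by (intro powr_mono2 suminf_nonneg) auto
    also have "\<dots> = ?a + ?b"
      using p a b by (simp add: powr_powr)
    finally show ?thesis using sm by (simp add: lp_def)
  qed
  then show "(\<lambda>n. x n + y n) \<in> lp p" "lp_norm p (\<lambda>n. x n + y n) \<le> ?a + ?b" by blast+
qed

lemma Metric_space_lp:
  assumes p: "1 \<le> p" shows "Metric_space (lp p) (lp_dist p)"
proof
  have diff: "(\<lambda>n. x n - y n) \<in> lp p" if "x \<in> lp p" "y \<in> lp p" for x y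
    using lp_Minkowski(1)[OF p that(1), of "\<lambda>n. - y n"] that(2) by (simp add: lp_def)
  show "0 \<le> lp_dist p x y" for x y
    by (simp add: lp_dist_def lp_norm_nonneg)
  show "lp_dist p x y = lp_dist p y x" for x y
    by (simp add: lp_dist_def lp_norm_def abs_minus_commute)
  show "lp_dist p x y = 0 \<longleftrightarrow> x = y" if "x \<in> lp p" "y \<in> lp p" for x y
    using lp_norm_eq_0_iff[OF p diff[OF that]] by (simp add: lp_dist_def fun_eq_iff)
  show "lp_dist p x z \<le> lp_dist p x y + lp_dist p y z" if "x \<in> lp p" "y \<in> lp p" "z \<in> lp p" for x y z
    using lp_Minkowski(2)[OF p diff[OF that(1,2)] diff[OF that(2,3)]] by (simp add: lp_dist_def)
qed

definition lp_continuous_linear :: "real \<Rightarrow> ((nat \<Rightarrow> real) \<Rightarrow> nat \<Rightarrow> real) \<Rightarrow> bool"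
  where "lp_continuous_linear p A \<longleftrightarrow>
    (\<forall>x\<in>lp p. \<forall>y\<in>lp p. A (\<lambda>n. x n + y n) = (\<lambda>n. A x n + A y n)) \<and>
    (\<forall>c. \<forall>x\<in>lp p. A (\<lambda>n. c * x n) = (\<lambda>n. c * A x n)) \<and>
    continuous_map (lp_topology p) (lp_topology p) A"

text \<open>
  \<open>lp_has_frechet_derivative p T A x\<close>: the operator \<open>A\<close> is a Frechet derivative of \<open>T\<close> at \<open>x\<close>.
  Only the restrictions of \<open>T\<close> and \<open>A\<close> to \<open>l\<^sub>p\<close> matter.
\<close>

definition lp_has_frechet_derivative ::
    "real \<Rightarrow> ((nat \<Rightarrow> real) \<Rightarrow> nat \<Rightarrow> real) \<Rightarrow> ((nat \<Rightarrow> real) \<Rightarrow> nat \<Rightarrow> real) \<Rightarrow> (nat \<Rightarrow> real) \<Rightarrow> bool"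
  where "lp_has_frechet_derivative p T A x \<longleftrightarrow>
    x \<in> lp p \<and> T \<in> lp p \<rightarrow> lp p \<and> lp_continuous_linear p A \<and>
    limitin (lp_topology p)
      (\<lambda>u n. (T (\<lambda>k. x k + u k) n - T x n - A u n) / lp_norm p u) (\<lambda>n. 0)
      (atin (lp_topology p) (\<lambda>n. 0))"

definition lp_frechet_differentiable :: "real \<Rightarrow> ((nat \<Rightarrow> real) \<Rightarrow> nat \<Rightarrow> real) \<Rightarrow> bool"
  where "lp_frechet_differentiable p T \<longleftrightarrow> (\<forall>x\<in>lp p. \<exists>A. lp_has_frechet_derivative p T A x)"

definition lp_represented_by :: "real \<Rightarrow> ((nat \<Rightarrow> real) \<Rightarrow> nat \<Rightarrow> real) \<Rightarrow> (nat \<Rightarrow> nat \<Rightarrow> real) \<Rightarrow> bool"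
  where "lp_represented_by p A M \<longleftrightarrow> (\<forall>x\<in>lp p. \<forall>n. (\<lambda>k. M n k * x k) sums A x n)"

definition diagonal_matrix :: "(nat \<Rightarrow> real) \<Rightarrow> nat \<Rightarrow> nat \<Rightarrow> real"
  where "diagonal_matrix d n k = (if n = k then d n else 0)"

definition poly_op :: "nat \<Rightarrow> (nat \<Rightarrow> real) \<Rightarrow> (nat \<Rightarrow> real) \<Rightarrow> nat \<Rightarrow> real"
  where "poly_op m a x = (\<lambda>n. \<Sum>i=1..m. a i * x n ^ i)"

end

theory Submission
  imports Defs
begin

text \<open>
  Since \<open>\<bar>x n\<bar> \<le> \<parallel>x\<parallel>\<close>, all coordinates of \<open>x\<close> and \<open>u\<close> stay in a bounded interval, on which the
  Taylor remainder of the polynomial is at most \<open>C (u n)\<^sup>2 \<le> C \<parallel>u\<parallel> \<bar>u n\<bar>\<close>. Hence the remainder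
  of the operator has norm at most \<open>C \<parallel>u\<parallel>\<^sup>2\<close>, and the coordinatewise derivative is the
  Frechet derivative. It is unique: two derivatives differ by \<open>o(\<parallel>u\<parallel>)\<close>, and along \<open>u = c y\<close> with
  \<open>c\<close> tending to 0 homogeneity forces them to agree at \<open>y\<close>.
\<close>

section \<open>Norm estimates in \<open>lp p\<close>: domination, scaling, coordinates\<close>

lemma lp_domination:
  assumes p: "1 \<le> p" and y: "y \<in> lp p" and C: "0 \<le> C" and le: "\<And>n. \<bar>z n\<bar> \<le> C * \<bar>y n\<bar>"
  shows "z \<in> lp p" "lp_norm p z \<le> C * lp_norm p y"
proof -
  have bound: "\<bar>z n\<bar> powr p \<le> C powr p * \<bar>y n\<bar> powr p" for n
    using powr_mono2[OF _ _ le[of n], of p] p C by (simp add: powr_mult)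
  have sy: "summable (\<lambda>n. \<bar>y n\<bar> powr p)"
    using y by (simp add: lp_def)
  have sz: "summable (\<lambda>n. \<bar>z n\<bar> powr p)"
    using bound by (intro summable_comparison_test'[OF summable_mult[OF sy, of "C powr p"]]) auto
  then show "z \<in> lp p"
    by (simp add: lp_def)
  have "(\<Sum>n. \<bar>z n\<bar> powr p) \<le> C powr p * (\<Sum>n. \<bar>y n\<bar> powr p)"
    using suminf_le[OF bound sz summable_mult[OF sy]] by (simp add: suminf_mult[OF sy])
  then have "lp_norm p z \<le> (C powr p * (\<Sum>n. \<bar>y n\<bar> powr p)) powr (1 / p)"
    unfolding lp_norm_def using p sz by (intro powr_mono2 suminf_nonneg) auto
  also have "\<dots> = C * lp_norm p y"
    using p C sy by (simp add: lp_norm_def powr_mult powr_powr suminf_nonneg)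
  finally show "lp_norm p z \<le> C * lp_norm p y" .
qed

lemma lp_cmult:
  assumes p: "1 \<le> p" and y: "y \<in> lp p"
  shows "(\<lambda>n. c * y n) \<in> lp p" "lp_norm p (\<lambda>n. c * y n) = \<bar>c\<bar> * lp_norm p y"
proof -
  have sy: "summable (\<lambda>n. \<bar>y n\<bar> powr p)"
    using y by (simp add: lp_def)
  show "(\<lambda>n. c * y n) \<in> lp p"
    by (rule lp_domination(1)[OF p y, of "\<bar>c\<bar>"]) (auto simp: abs_mult)
  show "lp_norm p (\<lambda>n. c * y n) = \<bar>c\<bar> * lp_norm p y"
    using p sy
    by (simp add: lp_norm_def abs_mult powr_mult powr_powr suminf_mult suminf_nonneg)
qed

lemma lp_diff:
  assumes p: "1 \<le> p" and x: "x \<in> lp p" and y: "y \<in> lp p"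
  shows "(\<lambda>n. x n - y n) \<in> lp p" "lp_norm p (\<lambda>n. x n - y n) \<le> lp_norm p x + lp_norm p y"
  using lp_Minkowski[OF p x lp_cmult(1)[OF p y, of "-1"]] lp_cmult(2)[OF p y, of "-1"] by simp_all

lemma zero_in_lp: "(\<lambda>n. 0) \<in> lp p"
  by (simp add: lp_def)

lemma lp_norm_zero: "lp_norm p (\<lambda>n. 0) = 0"
  by (simp add: lp_norm_def)

text \<open>A single term of a series of nonnegative terms is at most its sum. This makes bounds on
  coordinates uniform in \<open>n\<close>.\<close>

lemma lp_coord_le_norm:
  assumes p: "1 \<le> p" and x: "x \<in> lp p"
  shows "\<bar>x n\<bar> \<le> lp_norm p x"
proof -
  have "\<bar>x n\<bar> powr p \<le> (\<Sum>k. \<bar>x k\<bar> powr p)"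
    using sum_le_suminf[of "\<lambda>k. \<bar>x k\<bar> powr p" "{n}"] x by (simp add: lp_def)
  then have "(\<bar>x n\<bar> powr p) powr (1 / p) \<le> lp_norm p x"
    unfolding lp_norm_def using p by (intro powr_mono2) auto
  then show ?thesis
    using p by (simp add: powr_powr)
qed

section \<open>Limits at the origin and uniqueness of the derivative\<close>

lemma limitin_lp_at_zero_iff:
  assumes p: "1 \<le> p"
  shows "limitin (lp_topology p) f (\<lambda>n. 0) (atin (lp_topology p) (\<lambda>n. 0)) \<longleftrightarrow>
    (\<forall>\<epsilon>>0. \<exists>\<delta>>0. \<forall>u\<in>lp p. 0 < lp_norm p u \<and> lp_norm p u < \<delta> \<longrightarrow>
      f u \<in> lp p \<and> lp_norm p (f u) < \<epsilon>)"
proof -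
  interpret Metric_space "lp p" "lp_dist p"
    by (rule Metric_space_lp[OF p])
  \<comment> \<open>The distance to the zero sequence is the norm, so \<open>0 < lp_norm p u\<close>
    describes the punctured neighbourhood used by \<open>atin\<close>.\<close>
  show ?thesis
    by (simp add: lp_topology_def limitin_metric eventually_atin_metric zero_in_lp lp_dist_def
        Ball_def imp_conjL)
qed

lemma lp_has_frechet_derivative_unique:
  assumes p: "1 \<le> p" and A: "lp_has_frechet_derivative p T A x"
    and B: "lp_has_frechet_derivative p T B x" and y: "y \<in> lp p"
  shows "A y = B y"
proof -
  interpret Metric_space "lp p" "lp_dist p"
    by (rule Metric_space_lp[OF p])
  \<comment> \<open>The increment of \<open>T\<close> does not depend on \<open>D\<close>, so it
    cancels in \<open>R B u - R A u\<close>.\<close>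
  define R where "R D u n = (T (\<lambda>k. x k + u k) n - T x n - D u n) / lp_norm p u" for D u n
  define w where "w n = A y n - B y n" for n
  have linA: "lp_continuous_linear p A" and linB: "lp_continuous_linear p B"
    using A B by (auto simp: lp_has_frechet_derivative_def)
  \<comment> \<open>Being a \<open>continuous_map\<close> includes mapping \<open>lp p\<close> into
    itself.\<close>
  have cont: "D y \<in> lp p" if "lp_continuous_linear p D" for D
    using that y by (auto simp: lp_continuous_linear_def lp_topology_def continuous_map_def)
  have w: "w \<in> lp p"
    using lp_diff(1)[OF p cont[OF linA] cont[OF linB]] by (simp add: w_def[abs_def])
  have le: "lp_norm p w \<le> 2 * lp_norm p y * \<epsilon>" if "0 < \<epsilon>" for \<epsilon>
  \<comment> \<open>A zero \<open>y\<close> gives no direction to scale along; there homogeneity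
    with scalar 0 makes both values zero.\<close>
  proof (cases "lp_norm p y = 0")
    case True
    then have y0: "y = (\<lambda>n. 0)"
      using lp_norm_eq_0_iff[OF p y] by simp
    have "D y = (\<lambda>n. 0)" if "lp_continuous_linear p D" for D
    proof -
      have "D (\<lambda>n. 0 * y n) = (\<lambda>n. 0 * D y n)"
        using that y unfolding lp_continuous_linear_def by blast
      then show ?thesis by (simp add: y0)
    qed
    then show ?thesis
      using linA linB by (simp add: w_def[abs_def] True lp_norm_zero)
  next
    case False
    then have ny: "0 < lp_norm p y"
      using lp_norm_nonneg[of p y] by simp
    have "\<exists>\<delta>>0. \<forall>u\<in>lp p. 0 < lp_norm p u \<and> lp_norm p u < \<delta> \<longrightarrow>
        R D u \<in> lp p \<and> lp_norm p (R D u) < \<epsilon>" if "lp_has_frechet_derivative p T D x" for D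
      using that \<open>0 < \<epsilon>\<close>
      unfolding lp_has_frechet_derivative_def limitin_lp_at_zero_iff[OF p] R_def[abs_def] by blast
    from this[OF A] this[OF B] obtain \<delta>1 \<delta>2 where d: "0 < \<delta>1" "0 < \<delta>2"
      and d1: "\<And>u. u \<in> lp p \<Longrightarrow> 0 < lp_norm p u \<Longrightarrow> lp_norm p u < \<delta>1 \<Longrightarrow>
        R A u \<in> lp p \<and> lp_norm p (R A u) < \<epsilon>"
      and d2: "\<And>u. u \<in> lp p \<Longrightarrow> 0 < lp_norm p u \<Longrightarrow> lp_norm p u < \<delta>2 \<Longrightarrow>
        R B u \<in> lp p \<and> lp_norm p (R B u) < \<epsilon>"
      by blast
    \<comment> \<open>This scale gives \<open>c * y\<close> half the smaller radius as its norm, so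
      it lies in both punctured balls.\<close>
    define c where "c = min \<delta>1 \<delta>2 / (2 * lp_norm p y)"
    define u where "u n = c * y n" for n
    have c: "0 < c"
      using d ny by (simp add: c_def)
    have u: "u \<in> lp p" and nu: "lp_norm p u = c * lp_norm p y"
      using lp_cmult[OF p y, of c] c by (simp_all add: u_def[abs_def])
    have "lp_norm p u = min \<delta>1 \<delta>2 / 2"
      using ny by (simp add: nu c_def)
    then have small: "0 < lp_norm p u" "lp_norm p u < \<delta>1" "lp_norm p u < \<delta>2"
      using d by auto
    note RA = d1[OF u small(1,2)] and RB = d2[OF u small(1,3)]
    have lin: "D u = (\<lambda>n. c * D y n)" if "lp_continuous_linear p D" for D
      using that y unfolding lp_continuous_linear_def u_def[abs_def] by blast
    \<comment> \<open>By homogeneity \<open>R B u - R A u\<close> is \<open>c * w\<close> divided by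
      \<open>c * lp_norm p y\<close>, so the scale \<open>c\<close> cancels.\<close>
    have weq: "w = (\<lambda>n. lp_norm p y * (R B u n - R A u n))"
      using c ny by (simp add: w_def R_def lin[OF linA] lin[OF linB] nu fun_eq_iff field_simps)
    have "lp_norm p w = lp_norm p y * lp_norm p (\<lambda>n. R B u n - R A u n)"
      unfolding weq using lp_cmult(2)[OF p lp_diff(1)[OF p, of "R B u" "R A u"]] RA RB ny by simp
    also have "\<dots> \<le> lp_norm p y * (2 * \<epsilon>)"
      using lp_diff(2)[OF p, of "R B u" "R A u"] RA RB ny by (intro mult_left_mono) auto
    finally show ?thesis by (simp add: mult_ac)
  qed
  \<comment> \<open>The \<open>+ 1\<close> in the denominator keeps it positive even for
    \<open>y\<close> of norm zero.\<close>
  have "lp_norm p w \<le> 0 + e" if e: "0 < e" for e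
  proof -
    have k: "0 < 2 * lp_norm p y + 1"
      using lp_norm_nonneg[of p y] by simp
    have "lp_norm p w \<le> 2 * lp_norm p y * (e / (2 * lp_norm p y + 1))"
      using k e by (intro le) simp
    also have "\<dots> \<le> (2 * lp_norm p y + 1) * (e / (2 * lp_norm p y + 1))"
      using k e by (intro mult_right_mono) simp_all
    finally show ?thesis
      using k by simp
  qed
  then have "lp_norm p w \<le> 0"
    by (rule field_le_epsilon)
  then have "w = (\<lambda>n. 0)"
    using lp_norm_nonneg[of p w] lp_norm_eq_0_iff[OF p w] by simp
  then show ?thesis
    by (simp add: w_def fun_eq_iff)
qed

section \<open>Bounded diagonal operators\<close>

lemma diagonal_lp_continuous_linear:
  assumes p: "1 \<le> p" and C: "0 \<le> C" and d: "\<And>n. \<bar>d n\<bar> \<le> C"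
  shows "lp_continuous_linear p (\<lambda>y n. d n * y n)"
proof -
  interpret Metric_space "lp p" "lp_dist p"
    by (rule Metric_space_lp[OF p])
  have le: "\<bar>d n * z\<bar> \<le> C * \<bar>z\<bar>" for n z
    by (simp add: abs_mult mult_right_mono d)
  \<comment> \<open>Lipschitz bound, by domination of the image of \<open>y - z\<close>. The
    instance \<open>\<lambda>n. n\<close> makes coordinate \<open>n\<close> use the entry
    \<open>d n\<close>, an index that unification leaves open.\<close>
  have bound: "lp_dist p (\<lambda>n. d n * y n) (\<lambda>n. d n * z n) \<le> C * lp_dist p y z"
    if "y \<in> lp p" "z \<in> lp p" for y z
    using lp_domination(2)[OF p lp_diff(1)[OF p that] C le, of "\<lambda>n. n"]
    by (simp add: lp_dist_def right_diff_distrib)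
  have "continuous_map (lp_topology p) (lp_topology p) (\<lambda>y n. d n * y n)"
    unfolding lp_topology_def metric_continuous_map[OF Metric_space_axioms]
  proof (intro conjI ballI allI impI)
    show "(\<lambda>y n. d n * y n) ` lp p \<subseteq> lp p"
      by (rule image_subsetI) (rule lp_domination(1)[OF p _ C le])
  next
    fix y and \<epsilon> :: real
    assume y: "y \<in> lp p" and e: "0 < \<epsilon>"
    show "\<exists>\<delta>>0. \<forall>z. z \<in> lp p \<and> lp_dist p y z < \<delta> \<longrightarrow>
        lp_dist p (\<lambda>n. d n * y n) (\<lambda>n. d n * z n) < \<epsilon>"
    \<comment> \<open>Dividing by \<open>C + 1\<close> also covers \<open>C = 0\<close>.\<close>
    proof (intro exI[of _ "\<epsilon> / (C + 1)"] conjI allI impI)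
      show "0 < \<epsilon> / (C + 1)" using e C by simp
      fix z assume z: "z \<in> lp p \<and> lp_dist p y z < \<epsilon> / (C + 1)"
      have "lp_dist p (\<lambda>n. d n * y n) (\<lambda>n. d n * z n) \<le> C * lp_dist p y z"
        using bound y z by blast
      also have "\<dots> \<le> (C + 1) * lp_dist p y z"
        by (simp add: distrib_right)
      also have "\<dots> < \<epsilon>"
        using z C by (simp add: pos_less_divide_eq mult.commute)
      finally show "lp_dist p (\<lambda>n. d n * y n) (\<lambda>n. d n * z n) < \<epsilon>" .
    qed
  qed
  then show ?thesis
    by (simp add: lp_continuous_linear_def algebra_simps)
qed

section \<open>The polynomial operator and its Taylor remainder\<close>

lemma power_Taylor_remainder_le:
  fixes s t R :: real
  assumes "\<bar>s\<bar> \<le> R" "\<bar>s + t\<bar> \<le> R"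
  shows "\<bar>(s + t) ^ i - s ^ i - real i * s ^ (i - 1) * t\<bar> \<le>
    real i * real (i - 1) * R ^ (i - 2) * t\<^sup>2"
\<comment> \<open>The difference quotient in \<open>lemma_termdiff3\<close> requires a nonzero
  \<open>t\<close>. Truncated exponents are harmless: for \<open>i \<le> 1\<close> the factor
  \<open>real i * real (i - 1)\<close> is 0.\<close>
proof (cases "t = 0")
  case False
  have "(s + t) ^ i - s ^ i - real i * s ^ (i - 1) * t
      = (((s + t) ^ i - s ^ i) / t - real i * s ^ (i - 1)) * t"
    using False by (simp add: field_simps)
  then have "\<bar>(s + t) ^ i - s ^ i - real i * s ^ (i - 1) * t\<bar>
      = \<bar>((s + t) ^ i - s ^ i) / t - real i * s ^ (i - 1)\<bar> * \<bar>t\<bar>"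
    by (simp only: abs_mult)
  also have "\<dots> \<le> real i * real (i - 1) * R ^ (i - 2) * \<bar>t\<bar> * \<bar>t\<bar>"
    using lemma_termdiff3[of t s R i] assms False by (intro mult_right_mono) simp_all
  finally show ?thesis
    by (simp add: power2_eq_square mult.assoc)
qed simp

lemma poly_op_in_lp:
  assumes p: "1 \<le> p" and x: "x \<in> lp p"
  shows "poly_op m a x \<in> lp p"
proof -
  \<comment> \<open>Every monomial has degree at least 1, so one factor
    \<open>\<bar>x n\<bar>\<close> splits off and the remaining powers are bounded through the
    norm.\<close>
  let ?C = "\<Sum>i=1..m. \<bar>a i\<bar> * lp_norm p x ^ (i - 1)"
  show ?thesis
  proof (rule lp_domination(1)[OF p x, of ?C])
    show "0 \<le> ?C"
      by (intro sum_nonneg) (simp add: lp_norm_nonneg)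
    fix n
    have "\<bar>poly_op m a x n\<bar> \<le> (\<Sum>i=1..m. \<bar>a i * x n ^ i\<bar>)"
      unfolding poly_op_def by (rule sum_abs)
    also have "\<dots> \<le> (\<Sum>i=1..m. \<bar>a i\<bar> * lp_norm p x ^ (i - 1) * \<bar>x n\<bar>)"
    proof (rule sum_mono)
      fix i assume i: "i \<in> {1..m}"
      have "\<bar>a i * x n ^ i\<bar> = \<bar>a i\<bar> * \<bar>x n\<bar> ^ (i - 1) * \<bar>x n\<bar>"
        using i by (cases i) (simp_all add: abs_mult power_abs)
      also have "\<dots> \<le> \<bar>a i\<bar> * lp_norm p x ^ (i - 1) * \<bar>x n\<bar>"
        by (intro mult_right_mono mult_left_mono power_mono lp_coord_le_norm[OF p x]) auto
      finally show "\<bar>a i * x n ^ i\<bar> \<le> \<bar>a i\<bar> * lp_norm p x ^ (i - 1) * \<bar>x n\<bar>" .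
    qed
    finally show "\<bar>poly_op m a x n\<bar> \<le> ?C * \<bar>x n\<bar>"
      by (simp add: sum_distrib_right)
  qed
qed

lemma poly_op_has_frechet_derivative:
  assumes p: "1 \<le> p" and x: "x \<in> lp p"
  shows "lp_has_frechet_derivative p (poly_op m a)
    (\<lambda>y n. (\<Sum>i=1..m. real i * a i * x n ^ (i - 1)) * y n) x"
proof -
  define d where "d n = (\<Sum>i=1..m. real i * a i * x n ^ (i - 1))" for n
  \<comment> \<open>A bound on all diagonal entries, which makes the candidate derivative
    continuous.\<close>
  define K where "K = (\<Sum>i=1..m. real i * \<bar>a i\<bar> * lp_norm p x ^ (i - 1))"
  \<comment> \<open>Taylor constants for the interval of radius \<open>lp_norm p x + 1\<close>,
    which contains every \<open>x n\<close> and \<open>x n + u n\<close> when \<open>u\<close> has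
    norm at most 1.\<close>
  define C where
    "C = (\<Sum>i=1..m. \<bar>a i\<bar> * (real i * real (i - 1) * (lp_norm p x + 1) ^ (i - 2)))"
  define r where "r u n = poly_op m a (\<lambda>k. x k + u k) n - poly_op m a x n - d n * u n" for u n
  have C0: "0 \<le> C"
    unfolding C_def by (intro sum_nonneg) (simp add: lp_norm_nonneg)
  have K0: "0 \<le> K"
    unfolding K_def by (intro sum_nonneg) (simp add: lp_norm_nonneg)
  have dK: "\<bar>d n\<bar> \<le> K" for n
  proof -
    have "\<bar>d n\<bar> \<le> (\<Sum>i=1..m. \<bar>real i * a i * x n ^ (i - 1)\<bar>)"
      unfolding d_def by (rule sum_abs)
    also have "\<dots> \<le> K"
      unfolding K_def abs_mult power_abs
      by (intro sum_mono mult_mono power_mono lp_coord_le_norm[OF p x]) auto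
    finally show ?thesis .
  qed
  have rem: "r u \<in> lp p" "lp_norm p (r u) \<le> C * lp_norm p u * lp_norm p u"
    if u: "u \<in> lp p" and small: "lp_norm p u \<le> 1" for u
  proof -
    have le: "\<bar>r u n\<bar> \<le> (C * lp_norm p u) * \<bar>u n\<bar>" for n
    proof -
      have R: "\<bar>x n\<bar> \<le> lp_norm p x + 1" "\<bar>x n + u n\<bar> \<le> lp_norm p x + 1"
        using lp_coord_le_norm[OF p x, of n] lp_coord_le_norm[OF p u, of n] small by linarith+
      have eq: "r u n = (\<Sum>i=1..m. a i * ((x n + u n) ^ i - x n ^ i - real i * x n ^ (i - 1) * u n))"
        by (simp add: r_def d_def poly_op_def sum_distrib_right flip: sum_subtractf)
          (simp add: algebra_simps)
      have "\<bar>r u n\<bar> \<le>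
          (\<Sum>i=1..m. \<bar>a i * ((x n + u n) ^ i - x n ^ i - real i * x n ^ (i - 1) * u n)\<bar>)"
        unfolding eq by (rule sum_abs)
      also have "\<dots> \<le> (\<Sum>i=1..m.
          \<bar>a i\<bar> * (real i * real (i - 1) * (lp_norm p x + 1) ^ (i - 2) * (u n)\<^sup>2))"
      proof (rule sum_mono)
        fix i
        show "\<bar>a i * ((x n + u n) ^ i - x n ^ i - real i * x n ^ (i - 1) * u n)\<bar> \<le>
            \<bar>a i\<bar> * (real i * real (i - 1) * (lp_norm p x + 1) ^ (i - 2) * (u n)\<^sup>2)"
          unfolding abs_mult[of "a i"]
          by (rule mult_left_mono[OF power_Taylor_remainder_le[OF R] abs_ge_zero])
      qed
      also have "\<dots> = C * (\<bar>u n\<bar> * \<bar>u n\<bar>)"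
        by (simp add: C_def sum_distrib_right power2_eq_square mult.assoc)
      \<comment> \<open>Only one of the two factors is replaced by the norm; the other remains as
        the dominating sequence.\<close>
      also have "\<dots> \<le> C * (lp_norm p u * \<bar>u n\<bar>)"
        using C0 by (intro mult_left_mono mult_right_mono lp_coord_le_norm[OF p u]) auto
      finally show ?thesis by (simp add: mult.assoc)
    qed
    show "r u \<in> lp p" "lp_norm p (r u) \<le> C * lp_norm p u * lp_norm p u"
      using lp_domination[OF p u _ le] C0 lp_norm_nonneg[of p u] by auto
  qed
  have "\<exists>\<delta>>0. \<forall>u\<in>lp p. 0 < lp_norm p u \<and> lp_norm p u < \<delta> \<longrightarrow>
      (\<lambda>n. r u n / lp_norm p u) \<in> lp p \<and> lp_norm p (\<lambda>n. r u n / lp_norm p u) < \<epsilon>"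
    if e: "0 < \<epsilon>" for \<epsilon>
  \<comment> \<open>The bound 1 makes \<open>rem\<close> applicable; the other one brings the
    quotient, at most \<open>C * lp_norm p u\<close>, below \<open>\<epsilon>\<close>.\<close>
  proof (intro exI[of _ "min 1 (\<epsilon> / (C + 1))"] conjI ballI impI; (elim conjE)?)
    show "0 < min 1 (\<epsilon> / (C + 1))"
      using e C0 by simp
    fix u assume u: "u \<in> lp p" and pos: "0 < lp_norm p u"
      and small: "lp_norm p u < min 1 (\<epsilon> / (C + 1))"
    have ru: "r u \<in> lp p" "lp_norm p (r u) \<le> C * lp_norm p u * lp_norm p u"
      using rem[OF u] small by auto
    show "(\<lambda>n. r u n / lp_norm p u) \<in> lp p"
      using lp_cmult(1)[OF p ru(1), of "1 / lp_norm p u"] by simp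
    have "lp_norm p (\<lambda>n. r u n / lp_norm p u) = lp_norm p (r u) / lp_norm p u"
      using lp_cmult(2)[OF p ru(1), of "1 / lp_norm p u"] pos by simp
    also have "\<dots> \<le> C * lp_norm p u"
      using ru(2) pos by (simp add: pos_divide_le_eq)
    also have "\<dots> \<le> (C + 1) * lp_norm p u"
      using pos by (simp add: distrib_right)
    also have "\<dots> < \<epsilon>"
      using small C0 by (simp add: pos_less_divide_eq mult.commute)
    finally show "lp_norm p (\<lambda>n. r u n / lp_norm p u) < \<epsilon>" .
  qed
  then show ?thesis
    using x poly_op_in_lp[OF p] diagonal_lp_continuous_linear[OF p K0, of d] dK
    unfolding lp_has_frechet_derivative_def limitin_lp_at_zero_iff[OF p] r_def d_def[symmetric]
    by blast
qed

section \<open>Matrix representation and the final formulas\<close>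

lemma lp_represented_by_diagonal:
  assumes "\<And>y. y \<in> lp p \<Longrightarrow> A y = (\<lambda>n. d n * y n)"
  shows "lp_represented_by p A (diagonal_matrix d)"
proof -
  \<comment> \<open>Each row has at most one nonzero term; this orientation of the test matches
    \<open>sums_single\<close>.\<close>
  have eq: "diagonal_matrix d n k * y k = (if k = n then d k * y k else 0)" for n k y
    by (simp add: diagonal_matrix_def)
  show ?thesis
    unfolding lp_represented_by_def eq
    using sums_single[of _ "\<lambda>k. d k * y k" for y] assms by simp
qed

theorem theorem3p2:
  fixes p :: real and m :: nat and a :: "nat \<Rightarrow> real"
  assumes "1 < p" and "1 \<le> m"
  shows "poly_op m a \<in> lp p \<rightarrow> lp p \<and>
    lp_frechet_differentiable p (poly_op m a) \<and>
    (\<forall>x\<in>lp p. \<forall>A. lp_has_frechet_derivative p (poly_op m a) A x \<longrightarrow>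
      (1 < m \<longrightarrow>
        lp_represented_by p A (diagonal_matrix (\<lambda>n. \<Sum>i=1..m. real i * a i * x n ^ (i - 1))) \<and>
        (\<forall>y\<in>lp p. A y = (\<lambda>n. \<Sum>i=1..m. real i * a i * x n ^ (i - 1) * y n) \<and>
          (\<lambda>n. \<Sum>i=1..m. real i * a i * x n ^ (i - 1) * y n) \<in> lp p)) \<and>
      (m = 1 \<longrightarrow>
        (\<forall>y\<in>lp p. A y = (\<lambda>n. a 1 * y n) \<and> (\<lambda>n. a 1 * y n) \<in> lp p)))"
proof (intro conjI ballI allI impI)
  have p: "1 \<le> p" using assms(1) by simp
  show "poly_op m a \<in> lp p \<rightarrow> lp p"
    using poly_op_in_lp[OF p] by blast
  show "lp_frechet_differentiable p (poly_op m a)"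
    unfolding lp_frechet_differentiable_def using poly_op_has_frechet_derivative[OF p] by blast
  fix x A
  assume x: "x \<in> lp p" and A: "lp_has_frechet_derivative p (poly_op m a) A x"
  \<comment> \<open>Uniqueness turns the explicit derivative into a statement about every derivative
    \<open>A\<close>.\<close>
  have mult: "A y = (\<lambda>n. (\<Sum>i=1..m. real i * a i * x n ^ (i - 1)) * y n)" if "y \<in> lp p" for y
    using lp_has_frechet_derivative_unique[OF p A poly_op_has_frechet_derivative[OF p x] that] .
  then show "lp_represented_by p A (diagonal_matrix (\<lambda>n. \<Sum>i=1..m. real i * a i * x n ^ (i - 1)))"
    by (rule lp_represented_by_diagonal)
  fix y assume y: "y \<in> lp p"
  show eq: "A y = (\<lambda>n. \<Sum>i=1..m. real i * a i * x n ^ (i - 1) * y n)"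
    by (simp add: mult[OF y] sum_distrib_right)
  have Ay: "A y \<in> lp p"
    using A y Metric_space.topspace_mtopology[OF Metric_space_lp[OF p]]
    by (auto simp: lp_has_frechet_derivative_def lp_continuous_linear_def lp_topology_def
        continuous_map_def)
  then show "(\<lambda>n. \<Sum>i=1..m. real i * a i * x n ^ (i - 1) * y n) \<in> lp p"
    by (simp add: eq)
  assume "m = 1"
  \<comment> \<open>The only exponent is \<open>1 - 1 = 0\<close>, and \<open>0 ^ 0 = 1\<close>
    gives the entry \<open>a 1\<close> even where \<open>x n = 0\<close>.\<close>
  then show eq1: "A y = (\<lambda>n. a 1 * y n)"
    by (simp add: eq)
  show "(\<lambda>n. a 1 * y n) \<in> lp p"
    using Ay by (simp add: eq1)
qed

end
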